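(* Let $h:\mathbb{R}^n\to\overline{\mathbb{R}}$ be a proper function with convex domain, and let $\overline{x}\in\arg\min_{\mathbb{R}^n}h$. Let $\kappa\in(0,1]$ and $\gamma\ge 0$. Assume that $h$ is locally Lipschitz on $\mathrm{dom}(h)$. Then $h$ is $(\kappa,\gamma)$-strongly quasar-convex with respect to $\overline{x}$ if and only if $$h(\overline{x})\ge h(x)+\frac{1}{\kappa}\langle v,\overline{x}-x\rangle+\frac{\gamma}{2}\|x-\overline{x}\|^2,\qquad\forall\,x\in\mathrm{dom}(h),\ \forall\,v\in\partial^Ch(x).$$
   Context: $\overline{\mathbb{R}}=\mathbb{R}\cup\{+\infty\}$; $\mathrm{dom}(h)=\{x:h(x)<+\infty\}$; $h$ is proper if $\mathrm{dom}(h)\neq\emptyset$; $\|\cdot\|$ is the Euclidean norm. Locally Lipschitz on $\mathrm{dom}(h)$ means that every $x\in\mathrm{dom}(h)$ has an open neighborhood in $\mathbb{R}^n$ on which $h$ is (finite and) Lipschitz. Let $\kappa\in(0,1]$, $\gamma\ge 0$. A proper function $h:\mathbb{R}^n\to\overline{\mathbb{R}}$ with convex domain and $\arg\min_{\mathbb{R}^n}h\neq\emptyset$ is called $(\kappa,\gamma)$-strongly quasar-convex with respect to $\overline{x}\in\arg\min_{\mathbb{R}^n}h$ if for all $x\in\mathrm{dom}(h)$ and all $\lambda\in[0,1]$, $$h(\lambda\overline{x}+(1-\lambda)x)\le\kappa\lambda h(\overline{x})+(1-\kappa\lambda)h(x)-\lambda\left(1-\frac{\lambda}{2-\kappa}\right)\frac{\kappa\gamma}{2}\|x-\overline{x}\|^2.$$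 The Clarke directional derivative is $h^\circ(x;d)=\limsup_{y\to x,\,t\downarrow 0}\frac{h(y+td)-h(y)}{t}$, and the Clarke subdifferential is $\partial^Ch(x)=\{v\in\mathbb{R}^n:\langle v,d\rangle\le h^\circ(x;d)\ \forall d\in\mathbb{R}^n\}$ for $x\in\mathrm{dom}(h)$, and $\partial^Ch(x)=\emptyset$ otherwise. *)

theory Defs
  imports "HOL-Analysis.Analysis"
begin

definition edomain :: "('a \<Rightarrow> ereal) \<Rightarrow> 'a set" where
  "edomain h = {x. h x < \<infinity>}"

text \<open>Functions into \<open>\<real> \<union> {+\<infinity>}\<close> are rendered as
  \<^typ>\<open>ereal\<close>-valued functions; the first conjunct below removes the
  value \<open>-\<infinity>\<close>.\<close>

definition proper_fun :: "('a \<Rightarrow> ereal) \<Rightarrow> bool" where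
  "proper_fun h \<longleftrightarrow> (\<forall>x. h x \<noteq> -\<infinity>) \<and> edomain h \<noteq> {}"

definition argmin :: "('a \<Rightarrow> ereal) \<Rightarrow> 'a set" where
  "argmin h = {x. is_arg_min h (\<lambda>_. True) x}"

definition locally_lipschitz_on_edomain :: "('a::metric_space \<Rightarrow> ereal) \<Rightarrow> bool" where
  "locally_lipschitz_on_edomain h \<longleftrightarrow>
     (\<forall>x\<in>edomain h. \<exists>U L. open U \<and> x \<in> U \<and> (\<forall>y\<in>U. \<bar>h y\<bar> \<noteq> \<infinity>) \<and>
        L-lipschitz_on U (\<lambda>y. real_of_ereal (h y)))"

text \<open>For \<open>x\<close> in the domain and \<open>xbar\<close> a minimiser of a proper function, all terms on the
  right-hand side of the inequality are finite, so no convention for infinite arithmetic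
  is involved.\<close>

definition strongly_quasar_convex ::
    "real \<Rightarrow> real \<Rightarrow> ('a::real_normed_vector \<Rightarrow> ereal) \<Rightarrow> 'a \<Rightarrow> bool" where
  "strongly_quasar_convex \<kappa> \<gamma> h xbar \<longleftrightarrow>
     0 < \<kappa> \<and> \<kappa> \<le> 1 \<and> 0 \<le> \<gamma> \<and> proper_fun h \<and> convex (edomain h) \<and> xbar \<in> argmin h \<and>
     (\<forall>x\<in>edomain h. \<forall>l\<in>{0..1}.
        h (l *\<^sub>R xbar + (1 - l) *\<^sub>R x)
          \<le> ereal (\<kappa> * l) * h xbar + ereal (1 - \<kappa> * l) * h x
             - ereal (l * (1 - l / (2 - \<kappa>)) * (\<kappa> * \<gamma> / 2) * (norm (x - xbar))\<^sup>2))"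

text \<open>The base point \<open>y\<close> ranges over full neighbourhoods of \<open>x\<close>, with \<open>y = x\<close> allowed.
  If \<open>h\<close> is finite near \<open>x\<close>, the difference quotients are eventually finite along
  this filter.\<close>

definition clarke_dderiv :: "('a::real_normed_vector \<Rightarrow> ereal) \<Rightarrow> 'a \<Rightarrow> 'a \<Rightarrow> ereal" where
  "clarke_dderiv h x d =
     Limsup (nhds x \<times>\<^sub>F at_right (0::real)) (\<lambda>(y, t). (h (y + t *\<^sub>R d) - h y) / ereal t)"

definition clarke_subdiff :: "('a::real_inner \<Rightarrow> ereal) \<Rightarrow> 'a \<Rightarrow> 'a set" where
  "clarke_subdiff h x =
     (if x \<in> edomain h then {v. \<forall>d. ereal (v \<bullet> d) \<le> clarke_dderiv h x d} else {})"

end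

theory Submission
  imports Defs
begin

text \<open>
  Write \<open>f\<close> for the real-valued restriction of \<open>h\<close> to its domain, which is open because \<open>h\<close> is
  finite near each of its points, and \<open>m\<close> for the minimum \<open>f xbar\<close>. Both conditions are equivalent to
  a bound on the Clarke derivative along the segment towards \<open>xbar\<close>: for all \<open>x\<close> in the domain,
  \<open>h\<degree>(x; xbar - x) \<le> \<kappa> (m - f x) - \<kappa> \<gamma> / 2 * \<parallel>x - xbar\<parallel>\<^sup>2\<close>.

  Quasar-convexity at points \<open>y\<close> near \<open>x\<close> bounds the difference quotients of \<open>f\<close> at \<open>y\<close> in the
  direction \<open>xbar - y\<close>. The Lipschitz condition allows \<open>xbar - y\<close> to be replaced by \<open>xbar - x\<close> at a cost
  that vanishes as \<open>y \<rightarrow> x\<close>, and the upper limit is the bound above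
  (\<open>clarke_dderiv_le_of_strongly_quasar_convex\<close>). It passes to every subgradient \<open>v\<close> because
  \<open>v \<bullet> d \<le> h\<degree>(x; d)\<close>.

  Conversely, \<open>h\<degree>(x; \<cdot>)\<close> is finite and sublinear, so by a separation argument some subgradient
  attains it in a given direction (\<open>clarke_dderiv_attained\<close>), and the subgradient inequality
  yields the bound above. Let \<open>\<psi> u = f (u xbar + (1 - u) x) - m\<close> and
  \<open>C = \<kappa> \<gamma> / 2 * \<parallel>x - xbar\<parallel>\<^sup>2\<close>. Then the upper right Dini derivative of \<open>\<psi>\<close> on \<open>[0, 1)\<close> is at most
  \<open>- \<kappa> / (1 - u) * \<psi> u - C (1 - u)\<close>. With the integrating factor \<open>(1 - u) powr (- \<kappa>)\<close> this
  integrates to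
  \<open>\<psi> u \<le> (1 - u) powr \<kappa> * (\<psi> 0 - B) + B (1 - u)\<^sup>2\<close>, where \<open>B = C / (2 - \<kappa>)\<close>
  (\<open>Dini_inequality_decay\<close>). Since \<open>\<psi> \<ge> 0\<close>, letting \<open>u \<rightarrow> 1\<close> gives \<open>B \<le> \<psi> 0\<close>, and Bernoulli's
  inequality \<open>(1 - u) powr \<kappa> \<le> 1 - \<kappa> u\<close> turns the estimate into the defining inequality of
  quasar-convexity, because \<open>(1 - u)\<^sup>2 = 1 - \<kappa> u - u (2 - \<kappa> - u)\<close>
  (\<open>quasar_bound_of_Dini_inequality\<close>).
\<close>

section \<open>Linear minorants of sublinear functions\<close>

text \<open>The finite-dimensional Hahn-Banach theorem for a single direction: a hyperplane that separates
  the strict epigraph of \<open>p\<close> from the point \<open>(d0, p d0)\<close> is not vertical, and homogeneity of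
  \<open>p\<close> makes it pass through the origin.\<close>


lemma sublinear_has_exact_minorant:
  fixes p :: "'a::euclidean_space \<Rightarrow> real"
  assumes add: "\<And>d e. p (d + e) \<le> p d + p e"
    and scale: "\<And>s d. 0 < s \<Longrightarrow> p (s *\<^sub>R d) = s * p d"
  shows "\<exists>v. v \<bullet> d0 = p d0 \<and> (\<forall>d. v \<bullet> d \<le> p d)"
proof -
  define E where "E = {z :: 'a \<times> real. p (fst z) < snd z}"
  have p0: "p 0 = 0"
    using scale[of 2 0] by simp
  have "convex E"
    unfolding convex_def
  proof (intro ballI allI impI)
    fix y z :: "'a \<times> real" and u w :: real
    assume yz: "y \<in> E" "z \<in> E" and uw: "0 \<le> u" "0 \<le> w" "u + w = 1"
    have le: "p (s *\<^sub>R d) \<le> s * p d" if "0 \<le> s" for s d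
      using that scale[of s d] p0 by (cases "s = 0") auto
    have "p (u *\<^sub>R fst y + w *\<^sub>R fst z) \<le> u * p (fst y) + w * p (fst z)"
      using add[of "u *\<^sub>R fst y" "w *\<^sub>R fst z"] le[OF uw(1)] le[OF uw(2)]
      by (meson add_mono order_trans)
    also have "\<dots> < u * snd y + w * snd z"
    proof (cases "u = 0")
      case True
      then show ?thesis using yz uw by (simp add: E_def)
    next
      case False
      then have "u * p (fst y) < u * snd y" "w * p (fst z) \<le> w * snd z"
        using yz uw by (auto simp: E_def intro!: mult_left_mono)
      then show ?thesis by linarith
    qed
    finally show "u *\<^sub>R y + w *\<^sub>R z \<in> E"
      by (simp add: E_def)
  qed
  moreover have "(d0, p d0 + 1) \<in> E" "(d0, p d0) \<notin> E"
    by (auto simp: E_def)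
  ultimately obtain a b where a: "a \<noteq> 0"
    and lo: "a \<bullet> (d0, p d0) \<le> b" and up: "\<And>z. z \<in> E \<Longrightarrow> b \<le> a \<bullet> z"
    using separating_hyperplane_sets[of "{(d0, p d0)}" E] by fastforce
  obtain u \<alpha> where au: "a = (u, \<alpha>)"
    by (cases a)
  have sep: "u \<bullet> d0 + \<alpha> * p d0 \<le> u \<bullet> d + \<alpha> * r" if "p d < r" for d r
    using lo up[of "(d, r)"] that by (simp add: au E_def)
  have "0 \<le> \<alpha>"
    using sep[of d0 "p d0 + 1"] by (simp add: algebra_simps)
  moreover have "\<alpha> \<noteq> 0"
  proof
    assume "\<alpha> = 0"
    then have "u \<bullet> d0 \<le> u \<bullet> (d0 - u)"
      using sep[of "d0 - u" "p (d0 - u) + 1"] by simp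
    then have "u = 0"
      using inner_gt_zero_iff[of u] by (simp add: inner_diff_right del: inner_gt_zero_iff)
    with a \<open>\<alpha> = 0\<close> show False
      by (simp add: au zero_prod_def)
  qed
  ultimately have pos: "0 < \<alpha>"
    by simp
  define v where "v = (- (1 / \<alpha>)) *\<^sub>R u"
  have gap: "p d0 - v \<bullet> d0 \<le> p d - v \<bullet> d" for d
  proof (rule field_le_epsilon)
    fix e :: real
    assume "0 < e"
    then have "u \<bullet> d0 + \<alpha> * p d0 \<le> u \<bullet> d + \<alpha> * (p d + e)"
      by (intro sep) simp
    moreover have "\<alpha> * (v \<bullet> w) = - (u \<bullet> w)" for w
      using pos by (simp add: v_def)
    ultimately have "\<alpha> * (p d0 - v \<bullet> d0) \<le> \<alpha> * (p d - v \<bullet> d + e)"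
      by (simp add: algebra_simps)
    then show "p d0 - v \<bullet> d0 \<le> p d - v \<bullet> d + e"
      using pos by (simp add: mult_le_cancel_left_pos)
  qed
  have "p d0 - v \<bullet> d0 = 0"
    using gap[of 0] gap[of "2 *\<^sub>R d0"] p0 scale[of 2 d0] by simp
  then show ?thesis
    using gap by (intro exI[of _ v]) (auto simp: algebra_simps)
qed

section \<open>The Clarke directional derivative\<close>

lemma tendsto_fst_base: "(fst \<longlongrightarrow> x) (nhds x \<times>\<^sub>F at_right (0::real))"
  by (rule filterlim_fst)

lemma tendsto_snd_step: "(snd \<longlongrightarrow> 0) (nhds x \<times>\<^sub>F at_right (0::real))"
  by (rule filterlim_mono[OF filterlim_snd _ order_refl]) (simp add: at_within_le_nhds)

lemma tendsto_shifted_base: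
  fixes x d :: "'a::real_normed_vector"
  shows "((\<lambda>p. fst p + snd p *\<^sub>R d) \<longlongrightarrow> x) (nhds x \<times>\<^sub>F at_right (0::real))"
  using tendsto_add[OF tendsto_fst_base tendsto_scaleR[OF tendsto_snd_step tendsto_const]]
  by simp


lemma eventually_clarke_segment:
  fixes x d :: "'a::real_normed_vector"
  assumes "open U" "x \<in> U"
  shows "eventually (\<lambda>(y, t). y \<in> U \<and> y + t *\<^sub>R d \<in> U \<and> 0 < t) (nhds x \<times>\<^sub>F at_right (0::real))"
proof -
  have "eventually (\<lambda>p. fst p \<in> U) (nhds x \<times>\<^sub>F at_right (0::real))"
    using tendsto_fst_base assms by (rule topological_tendstoD)
  moreover have "eventually (\<lambda>p. fst p + snd p *\<^sub>R d \<in> U) (nhds x \<times>\<^sub>F at_right (0::real))"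
    using tendsto_shifted_base assms by (rule topological_tendstoD)
  moreover have "eventually (\<lambda>p. 0 < snd p) (nhds x \<times>\<^sub>F at_right (0::real))"
    using eventually_at_right_less filterlim_snd by (rule eventually_compose_filterlim)
  ultimately show ?thesis
    by eventually_elim auto
qed

text \<open>Upper bounds on the extended-real upper limit, restated for the real-valued function and
  without division. The slack \<open>e\<close> is needed because the upper limit need not bound any of the quotients.\<close>

lemma clarke_dderiv_le_iff:
  fixes h :: "'a::real_normed_vector \<Rightarrow> ereal"
  defines "f \<equiv> \<lambda>y. real_of_ereal (h y)"
  assumes U: "open U" "x \<in> U" and fin: "\<forall>y\<in>U. \<bar>h y\<bar> \<noteq> \<infinity>"
  shows "clarke_dderiv h x d \<le> ereal c \<longleftrightarrow>
    (\<forall>e>0. eventually (\<lambda>(y, t). f (y + t *\<^sub>R d) - f y \<le> (c + e) * t) (nhds x \<times>\<^sub>F at_right 0))"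
proof -
  let ?F = "nhds x \<times>\<^sub>F at_right (0::real)"
  let ?Q = "\<lambda>(y, t). (h (y + t *\<^sub>R d) - h y) / ereal t"
  have quot: "(h (y + t *\<^sub>R d) - h y) / ereal t = ereal ((f (y + t *\<^sub>R d) - f y) / t)"
    if "y \<in> U" "y + t *\<^sub>R d \<in> U" "0 < t" for y t
  proof -
    have "h y = ereal (f y)" "h (y + t *\<^sub>R d) = ereal (f (y + t *\<^sub>R d))"
      using fin that by (auto simp: f_def ereal_real)
    then show ?thesis
      using that by simp
  qed
  note seg = eventually_clarke_segment[OF U, of d]
  show ?thesis
  proof
    assume le: "clarke_dderiv h x d \<le> ereal c"
    show "\<forall>e>0. eventually (\<lambda>(y, t). f (y + t *\<^sub>R d) - f y \<le> (c + e) * t) ?F"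
    proof (intro allI impI)
      fix e :: real
      assume "0 < e"
      then have "eventually (\<lambda>p. ?Q p < ereal (c + e)) ?F"
        using le unfolding clarke_dderiv_def Limsup_le_iff by auto
      with seg show "eventually (\<lambda>(y, t). f (y + t *\<^sub>R d) - f y \<le> (c + e) * t) ?F"
        by eventually_elim (auto simp: quot divide_less_eq)
    qed
  next
    assume ev: "\<forall>e>0. eventually (\<lambda>(y, t). f (y + t *\<^sub>R d) - f y \<le> (c + e) * t) ?F"
    show "clarke_dderiv h x d \<le> ereal c"
      unfolding clarke_dderiv_def Limsup_le_iff
    proof (intro allI impI)
      fix b
      assume "ereal c < b"
      then obtain z where z: "c < z" "ereal z < b"
        using ereal_dense2 by (metis less_ereal.simps(1))
      from z have "eventually (\<lambda>(y, t). f (y + t *\<^sub>R d) - f y \<le> (c + (z - c)) * t) ?F"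
        using ev by (meson diff_gt_0_iff_gt)
      with seg show "eventually (\<lambda>p. ?Q p < b) ?F"
      proof eventually_elim
        case (elim p)
        obtain y t where p: "p = (y, t)"
          by (cases p)
        have "(f (y + t *\<^sub>R d) - f y) / t \<le> z"
          using elim by (auto simp: p divide_le_eq)
        then have "?Q p \<le> ereal z"
          using elim by (auto simp: p quot)
        with z show ?case
          by simp
      qed
    qed
  qed
qed

lemma clarke_dderiv_finite:
  fixes h :: "'a::real_normed_vector \<Rightarrow> ereal"
  assumes U: "open U" "x \<in> U" and fin: "\<forall>y\<in>U. \<bar>h y\<bar> \<noteq> \<infinity>"
    and lip: "L-lipschitz_on U (\<lambda>y. real_of_ereal (h y))"
  shows "\<bar>clarke_dderiv h x d\<bar> \<noteq> \<infinity>"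
proof -
  let ?f = "\<lambda>y. real_of_ereal (h y)"
  let ?F = "nhds x \<times>\<^sub>F at_right (0::real)"
  have bound: "eventually (\<lambda>(y, t). \<bar>?f (y + t *\<^sub>R d) - ?f y\<bar> \<le> L * norm d * t \<and> 0 < t) ?F"
    using eventually_clarke_segment[OF U, of d]
  proof eventually_elim
    case (elim p)
    then show ?case
      using lipschitz_onD[OF lip, of "fst p + snd p *\<^sub>R d" "fst p"]
      by (auto simp: dist_norm ac_simps)
  qed
  have "clarke_dderiv h x d \<le> ereal (L * norm d)"
  proof (subst clarke_dderiv_le_iff[OF U fin], intro allI impI)
    fix e :: real
    assume e: "0 < e"
    show "eventually (\<lambda>(y, t). ?f (y + t *\<^sub>R d) - ?f y \<le> (L * norm d + e) * t) ?F"
      using bound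
    proof eventually_elim
      case (elim p)
      then have "0 < e * snd p"
        using e by auto
      with elim show ?case
        by (auto simp: algebra_simps)
    qed
  qed
  \<comment> \<open>The quotients are at least \<open>- L * norm d\<close>, and \<open>- 2\<close> leaves room for the slack \<open>e = 1\<close>.\<close>
  moreover have "\<not> clarke_dderiv h x d \<le> ereal (- L * norm d - 2)"
  proof
    assume "clarke_dderiv h x d \<le> ereal (- L * norm d - 2)"
    then have "eventually (\<lambda>(y, t). ?f (y + t *\<^sub>R d) - ?f y \<le> (- L * norm d - 2 + 1) * t) ?F"
      using clarke_dderiv_le_iff[OF U fin, of d "- L * norm d - 2"] zero_less_one by blast
    with bound have "eventually (\<lambda>p. False) ?F"
      by eventually_elim (auto simp: algebra_simps abs_le_iff)
    then show False
      by (simp add: prod_filter_eq_bot)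
  qed
  ultimately show ?thesis
    by (cases "clarke_dderiv h x d") auto
qed

text \<open>The increment along \<open>d + e\<close> from \<open>y\<close> is the increment along \<open>d\<close> from \<open>y\<close> plus the increment
  along \<open>e\<close> from \<open>y + t d\<close>. Subadditivity holds because the base point of the Clarke derivative may
  vary, so the moving base point \<open>y + t d\<close> is admissible.\<close>

lemma clarke_dderiv_add:
  fixes h :: "'a::real_normed_vector \<Rightarrow> ereal"
  assumes U: "open U" "x \<in> U" and fin: "\<forall>y\<in>U. \<bar>h y\<bar> \<noteq> \<infinity>"
    and d: "clarke_dderiv h x d \<le> ereal a" and e: "clarke_dderiv h x e \<le> ereal b"
  shows "clarke_dderiv h x (d + e) \<le> ereal (a + b)"
proof (subst clarke_dderiv_le_iff[OF U fin], intro allI impI)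
  let ?f = "\<lambda>y. real_of_ereal (h y)"
  let ?F = "nhds x \<times>\<^sub>F at_right (0::real)"
  fix \<epsilon> :: real
  assume "0 < \<epsilon>"
  then have half: "0 < \<epsilon> / 2"
    by simp
  have "eventually (\<lambda>(y, t). ?f (y + t *\<^sub>R d) - ?f y \<le> (a + \<epsilon> / 2) * t) ?F"
    using d clarke_dderiv_le_iff[OF U fin, of d a] half by blast
  moreover have "eventually (\<lambda>(y, t). ?f (y + t *\<^sub>R e) - ?f y \<le> (b + \<epsilon> / 2) * t) ?F"
    using e clarke_dderiv_le_iff[OF U fin, of e b] half by blast
  then have "eventually (\<lambda>p. case (fst p + snd p *\<^sub>R d, snd p) of
      (y, t) \<Rightarrow> ?f (y + t *\<^sub>R e) - ?f y \<le> (b + \<epsilon> / 2) * t) ?F"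
    using filterlim_Pair[OF tendsto_shifted_base filterlim_snd]
    by (rule eventually_compose_filterlim)
  ultimately show "eventually (\<lambda>(y, t). ?f (y + t *\<^sub>R (d + e)) - ?f y \<le> (a + b + \<epsilon>) * t) ?F"
    by eventually_elim (auto simp: algebra_simps)
qed

lemma clarke_dderiv_scale:
  fixes h :: "'a::real_normed_vector \<Rightarrow> ereal"
  assumes U: "open U" "x \<in> U" and fin: "\<forall>y\<in>U. \<bar>h y\<bar> \<noteq> \<infinity>"
    and s: "0 < s" and d: "clarke_dderiv h x d \<le> ereal a"
  shows "clarke_dderiv h x (s *\<^sub>R d) \<le> ereal (s * a)"
proof (subst clarke_dderiv_le_iff[OF U fin], intro allI impI)
  let ?f = "\<lambda>y. real_of_ereal (h y)"
  let ?F = "nhds x \<times>\<^sub>F at_right (0::real)"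
  fix \<epsilon> :: real
  assume "0 < \<epsilon>"
  then have "0 < \<epsilon> / s"
    using s by simp
  then have "eventually (\<lambda>(y, t). ?f (y + t *\<^sub>R d) - ?f y \<le> (a + \<epsilon> / s) * t) ?F"
    using d clarke_dderiv_le_iff[OF U fin, of d a] by blast
  moreover have "filterlim (\<lambda>p. snd p * s) (at_right 0) ?F"
  proof -
    have "((\<lambda>p. snd p * s) \<longlongrightarrow> 0) ?F"
      using tendsto_mult_left_zero[OF tendsto_snd_step] .
    moreover have "eventually (\<lambda>p. 0 < snd p * s) ?F"
      using eventually_clarke_segment[OF U, of d] by eventually_elim (auto simp: s)
    ultimately show ?thesis
      by (auto simp: filterlim_at elim: eventually_mono)
  qed
  then have "filterlim (\<lambda>p. (fst p, snd p * s)) ?F ?F"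
    by (intro filterlim_Pair filterlim_fst)
  ultimately have "eventually (\<lambda>p. case (fst p, snd p * s) of
      (y, t) \<Rightarrow> ?f (y + t *\<^sub>R d) - ?f y \<le> (a + \<epsilon> / s) * t) ?F"
    by (rule eventually_compose_filterlim)
  then show "eventually (\<lambda>(y, t). ?f (y + t *\<^sub>R (s *\<^sub>R d)) - ?f y \<le> (s * a + \<epsilon>) * t) ?F"
  proof eventually_elim
    case (elim p)
    have "(a + \<epsilon> / s) * (snd p * s) = (s * a + \<epsilon>) * snd p"
      using s by (simp add: field_simps)
    with elim show ?case
      by (auto simp: case_prod_beta)
  qed
qed

text \<open>The Clarke derivative is the support function of the Clarke subdifferential, with the maximum
  attained.\<close>

lemma clarke_dderiv_attained:
  fixes h :: "'a::euclidean_space \<Rightarrow> ereal"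
  assumes U: "open U" "x \<in> U" and fin: "\<forall>y\<in>U. \<bar>h y\<bar> \<noteq> \<infinity>"
    and lip: "L-lipschitz_on U (\<lambda>y. real_of_ereal (h y))"
  shows "\<exists>v\<in>clarke_subdiff h x. clarke_dderiv h x d = ereal (v \<bullet> d)"
proof -
  define p where "p d = real_of_ereal (clarke_dderiv h x d)" for d
  have p: "clarke_dderiv h x d = ereal (p d)" for d
    using clarke_dderiv_finite[OF U fin lip] by (simp add: p_def ereal_real)
  have scale_le: "p (s *\<^sub>R d) \<le> s * p d" if "0 < s" for s d
    using clarke_dderiv_scale[OF U fin that, of d "p d"] by (simp add: p)
  have "p (s *\<^sub>R d) = s * p d" if "0 < s" for s d
  proof (rule antisym)
    have "p d \<le> 1 / s * p (s *\<^sub>R d)"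
      using scale_le[of "1 / s" "s *\<^sub>R d"] that by simp
    then show "s * p d \<le> p (s *\<^sub>R d)"
      using that by (simp add: field_simps)
  qed (rule scale_le[OF that])
  moreover have "p (d + e) \<le> p d + p e" for d e
    using clarke_dderiv_add[OF U fin, of d "p d" e "p e"] by (simp add: p)
  ultimately obtain v where "v \<bullet> d = p d" "\<forall>e. v \<bullet> e \<le> p e"
    using sublinear_has_exact_minorant[of p d] by blast
  moreover have "x \<in> edomain h"
    using fin U(2) by (auto simp: edomain_def less_top[symmetric])
  ultimately show ?thesis
    by (auto simp: clarke_subdiff_def p)
qed

section \<open>Differential inequalities for Dini derivatives\<close>

text \<open>The hypothesis says that the upper right Dini derivative of \<open>g\<close> is at most \<open>0\<close>. For each
  \<open>e > 0\<close>, the closed set of all \<open>s\<close> in \<open>[a, b]\<close> with \<open>g s \<le> g a + e * (s - a)\<close> has a largest element, and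
  this element can only be \<open>b\<close>.\<close>

lemma nonincreasing_of_upper_right_Dini:
  fixes g :: "real \<Rightarrow> real"
  assumes ab: "a \<le> b" and cont: "continuous_on {a..b} g"
    and dini: "\<And>u e. a \<le> u \<Longrightarrow> u < b \<Longrightarrow> 0 < e \<Longrightarrow>
      eventually (\<lambda>t. g (u + t) \<le> g u + e * t) (at_right 0)"
  shows "g b \<le> g a"
proof -
  have claim: "g b \<le> g a + e * (b - a)" if e: "0 < e" for e
  proof -
    define S where "S = {a..b} \<inter> (\<lambda>s. g s - e * s) -` {.. g a - e * a}"
    have "closed S"
      unfolding S_def by (intro continuous_closed_preimage continuous_intros cont)
    moreover have "bounded S"
      by (rule bounded_subset[OF bounded_closed_interval[of a b]]) (auto simp: S_def)
    moreover have "a \<in> S"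
      using ab by (simp add: S_def)
    ultimately obtain s where s: "s \<in> S" and max: "\<And>u. u \<in> S \<Longrightarrow> u \<le> s"
      using compact_attains_sup[of S] by (auto simp: compact_eq_bounded_closed)
    have "s = b"
    proof (rule ccontr)
      assume "s \<noteq> b"
      with s have sb: "a \<le> s" "s < b"
        by (auto simp: S_def)
      have "eventually (\<lambda>t. t < b - s) (at_right (0::real))"
        using sb by (intro eventually_at_rightI[of 0 "b - s"]) auto
      with dini[OF sb e] eventually_at_right_less[of "0::real"]
      have "eventually (\<lambda>t. s + t \<in> S \<and> 0 < t) (at_right 0)"
        by eventually_elim (use s sb in \<open>auto simp: S_def algebra_simps\<close>)
      then obtain t where "s + t \<in> S" "0 < t"
        using eventually_happens[of _ "at_right (0::real)"] by auto
      with max[of "s + t"] show False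
        by simp
    qed
    with s show ?thesis
      by (simp add: S_def algebra_simps)
  qed
  show ?thesis
  proof (rule field_le_epsilon)
    fix \<delta> :: real
    assume d: "0 < \<delta>"
    have "\<delta> / (b - a + 1) * (b - a) \<le> \<delta>"
      using d ab by (simp add: field_simps)
    with claim[of "\<delta> / (b - a + 1)"] show "g b \<le> g a + \<delta>"
      using d ab by (simp add: divide_pos_pos)
  qed
qed

lemma Bernoulli_powr_le:
  fixes \<kappa> :: real
  assumes "0 \<le> \<kappa>" "\<kappa> \<le> 1" "l < 1"
  shows "(1 - l) powr \<kappa> \<le> 1 - \<kappa> * l"
  using Youngs_inequality_0[of \<kappa> "1 - \<kappa>" "1 - l" 1] assms by (simp add: algebra_simps)

text \<open>A Gronwall estimate: the bound is the solution of
  \<open>\<psi>' = - \<kappa> / (1 - u) * \<psi> - C * (1 - u)\<close> with the same initial value. The singularity at \<open>u = 1\<close>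
  is the reason for the half-open interval.\<close>

lemma Dini_inequality_decay:
  fixes \<psi> :: "real \<Rightarrow> real" and \<kappa> C :: real
  assumes \<kappa>: "\<kappa> \<le> 1" and cont: "continuous_on {0..<1} \<psi>"
    and dini: "\<And>u e. 0 \<le> u \<Longrightarrow> u < 1 \<Longrightarrow> 0 < e \<Longrightarrow>
      eventually (\<lambda>t. \<psi> (u + t) \<le> \<psi> u + (- \<kappa> / (1 - u) * \<psi> u - C * (1 - u) + e) * t) (at_right 0)"
    and l: "0 \<le> l" "l < 1"
  shows "\<psi> l \<le> (1 - l) powr \<kappa> * (\<psi> 0 - C / (2 - \<kappa>)) + C / (2 - \<kappa>) * (1 - l)\<^sup>2"
proof -
  \<comment> \<open>\<open>w\<close> is the integrating factor and \<open>z' = - C * (1 - u) * w\<close>, so \<open>G\<close> is nonincreasing.\<close>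
  define w where "w u = (1 - u) powr (- \<kappa>)" for u :: real
  define z where "z u = C / (2 - \<kappa>) * (1 - u) powr (2 - \<kappa>)" for u :: real
  define G where "G u = w u * \<psi> u - z u" for u
  have w': "(w has_real_derivative \<kappa> / (1 - u) * w u) (at u)" if "u < 1" for u
    unfolding w_def using that
    by (auto intro!: derivative_eq_intros simp: powr_diff field_simps)
  have z': "(z has_real_derivative - C * (1 - u) * w u) (at u)" if "u < 1" for u
  proof -
    have "((\<lambda>u. (1 - u) powr (2 - \<kappa>)) has_real_derivative - (2 - \<kappa>) * (1 - u) powr (1 - \<kappa>)) (at u)"
      using that by (auto intro!: derivative_eq_intros simp: algebra_simps)
    then have "(z has_real_derivative C / (2 - \<kappa>) * (- (2 - \<kappa>) * (1 - u) powr (1 - \<kappa>))) (at u)"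
      unfolding z_def by (rule DERIV_cmult)
    moreover have "(1 - u) powr (1 - \<kappa>) = (1 - u) * w u"
      using that by (simp add: w_def powr_diff powr_minus field_simps)
    moreover have "C / (2 - \<kappa>) * (- (2 - \<kappa>) * X) = - C * X" for X
      using \<kappa> by (simp add: field_simps)
    ultimately show ?thesis
      by (simp only: mult.assoc)
  qed
  have quot: "((\<lambda>t. (f (u + t) - f u) / t) \<longlongrightarrow> D) (at_right 0)"
    if "(f has_real_derivative D) (at u)" for f :: "real \<Rightarrow> real" and D u
    using that unfolding DERIV_def by (rule tendsto_mono[rotated]) (simp add: at_le)
  have wpos: "0 < w u" if "u < 1" for u
    using that by (simp add: w_def)
  have "G l \<le> G 0"
  proof (rule nonincreasing_of_upper_right_Dini[OF l(1)])
    have "continuous_on {0..l} \<psi>"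
      using cont by (rule continuous_on_subset) (use l in auto)
    moreover have "continuous_on {0..l} w" "continuous_on {0..l} z"
      by (rule DERIV_continuous_on, rule DERIV_subset, rule w' z', use l in auto)+
    ultimately show "continuous_on {0..l} G"
      unfolding G_def by (intro continuous_intros)
  next
    fix u e :: real
    assume u: "0 \<le> u" "u < l" and e: "0 < e"
    have u1: "u < 1"
      using u l by simp
    define q where "q = - \<kappa> / (1 - u) * \<psi> u - C * (1 - u)"
    \<comment> \<open>The Dini bound is used with error \<open>\<delta>\<close>, which the factor \<open>w u\<close> turns into \<open>e / 2\<close>.\<close>
    define \<delta> where "\<delta> = e / (2 * w u)"
    have \<delta>: "0 < \<delta>"
      using e wpos[OF u1] by (simp add: \<delta>_def)
    \<comment> \<open>\<open>?R t\<close> bounds the difference quotient of \<open>G\<close>: in the product rule, the increment of \<open>\<psi>\<close>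
      is weighted by \<open>w (u + t)\<close> and not by \<open>w u\<close>, so continuity of \<open>\<psi>\<close> at \<open>u\<close> is not needed here.\<close>
    let ?R = "\<lambda>t. w (u + t) * (q + \<delta>) + \<psi> u * ((w (u + t) - w u) / t) - (z (u + t) - z u) / t"
    have "((\<lambda>t. u + t) \<longlongrightarrow> u + 0) (at_right 0)"
      by (intro tendsto_intros)
    then have "((\<lambda>t. w (u + t)) \<longlongrightarrow> w u) (at_right 0)"
      using isCont_tendsto_compose[OF DERIV_isCont[OF w'[OF u1]]] by simp
    then have "(?R \<longlongrightarrow> w u * (q + \<delta>) + \<psi> u * (\<kappa> / (1 - u) * w u) - (- C * (1 - u) * w u)) (at_right 0)"
      by (intro tendsto_intros quot w' z' u1)
    moreover have "w u * (q + \<delta>) + \<psi> u * (\<kappa> / (1 - u) * w u) - (- C * (1 - u) * w u) = e / 2"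
    proof -
      have "w u * \<delta> = e / 2"
        using wpos[OF u1] by (simp add: \<delta>_def)
      moreover have "W * (- k * P - C * r + \<delta>) + P * (k * W) - (- C * r * W) = W * \<delta>" for W k P r :: real
        by (simp add: algebra_simps)
      ultimately show ?thesis
        unfolding q_def by (metis minus_divide_left)
    qed
    ultimately have "(?R \<longlongrightarrow> e / 2) (at_right 0)"
      by (simp only:)
    then have "eventually (\<lambda>t. ?R t < e) (at_right 0)"
      by (rule order_tendstoD(2)) (use e in simp)
    moreover have "eventually (\<lambda>t. \<psi> (u + t) \<le> \<psi> u + (q + \<delta>) * t) (at_right 0)"
      using dini[OF u(1) u1 \<delta>] by (simp add: q_def)
    moreover have "eventually (\<lambda>t. t < 1 - u) (at_right (0::real))"
      using u1 by (intro eventually_at_rightI[of 0 "1 - u"]) auto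
    ultimately show "eventually (\<lambda>t. G (u + t) \<le> G u + e * t) (at_right 0)"
      using eventually_at_right_less[of "0::real"]
    proof eventually_elim
      case (elim t)
      have "w (u + t) * \<psi> (u + t) \<le> w (u + t) * (\<psi> u + (q + \<delta>) * t)"
        using elim wpos[of "u + t"] by (intro mult_left_mono) auto
      moreover have "?R t * t \<le> e * t"
        using elim by (intro mult_right_mono) auto
      moreover have "?R t * t = w (u + t) * (q + \<delta>) * t + \<psi> u * (w (u + t) - w u) - (z (u + t) - z u)"
        using elim by (simp add: field_simps)
      ultimately show ?case
        by (simp add: G_def algebra_simps)
    qed
  qed
  then have "w l * \<psi> l \<le> \<psi> 0 - C / (2 - \<kappa>) + z l"
    by (simp add: G_def w_def z_def)
  then have "(1 - l) powr \<kappa> * (w l * \<psi> l) \<le> (1 - l) powr \<kappa> * (\<psi> 0 - C / (2 - \<kappa>) + z l)"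
    by (rule mult_left_mono) simp
  moreover have "(1 - l) powr \<kappa> * w l = 1"
    using l by (simp add: w_def powr_minus)
  moreover have "(1 - l) powr \<kappa> * z l = C / (2 - \<kappa>) * (1 - l)\<^sup>2"
    using l by (simp add: z_def powr_diff)
  ultimately show ?thesis
    by (simp add: algebra_simps)
qed

text \<open>Besides the decay estimate, this uses that \<open>\<psi>\<close> stays nonnegative up to \<open>u = 1\<close>, which forces
  \<open>C / (2 - \<kappa>) \<le> \<psi> 0\<close>. Without this sign Bernoulli's inequality could not be applied. No
  continuity of \<open>\<psi>\<close> at \<open>1\<close> is assumed: the value there is treated separately.\<close>

lemma quasar_bound_of_Dini_inequality:
  fixes \<psi> :: "real \<Rightarrow> real" and \<kappa> C :: real
  assumes \<kappa>: "0 < \<kappa>" "\<kappa> \<le> 1" and cont: "continuous_on {0..<1} \<psi>"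
    and dini: "\<And>u e. 0 \<le> u \<Longrightarrow> u < 1 \<Longrightarrow> 0 < e \<Longrightarrow>
      eventually (\<lambda>t. \<psi> (u + t) \<le> \<psi> u + (- \<kappa> / (1 - u) * \<psi> u - C * (1 - u) + e) * t) (at_right 0)"
    and nonneg: "\<And>u. 0 \<le> u \<Longrightarrow> u < 1 \<Longrightarrow> 0 \<le> \<psi> u" and end0: "\<psi> 1 = 0"
    and l: "0 \<le> l" "l \<le> 1"
  shows "\<psi> l \<le> (1 - \<kappa> * l) * \<psi> 0 - l * (1 - l / (2 - \<kappa>)) * C"
proof -
  note decay = Dini_inequality_decay[OF \<kappa>(2) cont dini]
  define B where "B = C / (2 - \<kappa>)"
  have C: "C = B * (2 - \<kappa>)"
    using \<kappa> by (simp add: B_def)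
  \<comment> \<open>Divide \<open>0 \<le> \<psi> (1 - s) \<le> s powr \<kappa> * (\<psi> 0 - B) + B * s\<^sup>2\<close> by \<open>s powr \<kappa>\<close> and let \<open>s \<rightarrow> 0\<close>.\<close>
  have B: "0 \<le> \<psi> 0 - B"
  proof -
    have "((\<lambda>s. \<psi> 0 - B + B * s powr (2 - \<kappa>)) \<longlongrightarrow> \<psi> 0 - B + B * 0 powr (2 - \<kappa>)) (at_right 0)"
      using \<kappa> by (intro tendsto_intros tendsto_powr') 
        (auto intro: eventually_mono[OF eventually_at_right_less[of 0]])
    moreover have "eventually (\<lambda>s. 0 \<le> \<psi> 0 - B + B * s powr (2 - \<kappa>)) (at_right 0)"
    proof -
      have "eventually (\<lambda>s. s < 1) (at_right (0::real))"
        by (intro eventually_at_rightI[of 0 1]) auto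
      with eventually_at_right_less[of "0::real"] show ?thesis
      proof eventually_elim
        case (elim s)
        have "0 \<le> s powr \<kappa> * (\<psi> 0 - B) + B * s\<^sup>2"
          using decay[of "1 - s"] nonneg[of "1 - s"] elim by (simp add: B_def)
        also have "s\<^sup>2 = s powr \<kappa> * s powr (2 - \<kappa>)"
          using elim by (simp add: powr_add[symmetric])
        finally have "0 \<le> s powr \<kappa> * (\<psi> 0 - B + B * s powr (2 - \<kappa>))"
          by (simp add: algebra_simps)
        then show ?case
          using elim by (simp add: zero_le_mult_iff)
      qed
    qed
    ultimately have "0 \<le> \<psi> 0 - B + B * 0 powr (2 - \<kappa>)"
      by (intro tendsto_lowerbound) auto
    then show ?thesis
      by simp
  qed
  have rhs: "(1 - \<kappa> * l) * \<psi> 0 - l * (1 - l / (2 - \<kappa>)) * C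
    = (1 - \<kappa> * l) * (\<psi> 0 - B) + B * (1 - l)\<^sup>2"
    using \<kappa> by (simp add: C field_simps power2_eq_square)
  show ?thesis
  proof (cases "l = 1")
    case True
    then show ?thesis
      unfolding rhs using end0 B \<kappa> by simp
  next
    case False
    with l have "l < 1"
      by simp
    then have "\<psi> l \<le> (1 - l) powr \<kappa> * (\<psi> 0 - B) + B * (1 - l)\<^sup>2"
      using decay[of l] l by (simp add: B_def)
    also have "\<dots> \<le> (1 - \<kappa> * l) * (\<psi> 0 - B) + B * (1 - l)\<^sup>2"
      using Bernoulli_powr_le[of \<kappa> l] \<kappa> \<open>l < 1\<close> B by (intro add_right_mono mult_right_mono) auto
    finally show ?thesis
      unfolding rhs .
  qed
qed


section \<open>Strong quasar-convexity and Clarke subgradients\<close>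

lemma proper_fun_finite_on_edomain:
  assumes "proper_fun h" "x \<in> edomain h"
  shows "\<bar>h x\<bar> \<noteq> \<infinity>"
  using assms by (auto simp: proper_fun_def edomain_def)

lemma locally_lipschitz_on_edomainE:
  assumes "locally_lipschitz_on_edomain h" "x \<in> edomain h"
  obtains U L where "open U" "x \<in> U" "\<forall>y\<in>U. \<bar>h y\<bar> \<noteq> \<infinity>"
    "L-lipschitz_on U (\<lambda>y. real_of_ereal (h y))"
  using assms unfolding locally_lipschitz_on_edomain_def by blast

lemma clarke_dderiv_le_of_strongly_quasar_convex:
  fixes h :: "'a::real_normed_vector \<Rightarrow> ereal"
  defines "f \<equiv> \<lambda>y. real_of_ereal (h y)"
  assumes sqc: "strongly_quasar_convex \<kappa> \<gamma> h xbar"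
    and loc: "locally_lipschitz_on_edomain h" and x: "x \<in> edomain h"
  shows "clarke_dderiv h x (xbar - x)
    \<le> ereal (\<kappa> * (f xbar - f x) - \<kappa> * \<gamma> / 2 * (norm (x - xbar))\<^sup>2)"
proof -
  let ?F = "nhds x \<times>\<^sub>F at_right (0::real)"
  have proper: "proper_fun h" and min: "xbar \<in> argmin h" and \<kappa>: "\<kappa> \<le> 1"
    using sqc by (auto simp: strongly_quasar_convex_def)
  have "h xbar \<le> h x"
    using min by (simp add: argmin_def is_arg_min_linorder)
  then have xbar: "xbar \<in> edomain h"
    using x by (auto simp: edomain_def)
  have hf: "h y = ereal (f y)" if "y \<in> edomain h" for y
    using proper_fun_finite_on_edomain[OF proper that] by (simp add: f_def ereal_real)
  have ineq: "f (y + t *\<^sub>R (xbar - y)) - f y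
      \<le> t * (\<kappa> * (f xbar - f y) - (1 - t / (2 - \<kappa>)) * (\<kappa> * \<gamma> / 2) * (norm (y - xbar))\<^sup>2)"
    if y: "y \<in> edomain h" "y + t *\<^sub>R (xbar - y) \<in> edomain h" and t: "0 \<le> t" "t \<le> 1" for y t
  proof -
    have "t *\<^sub>R xbar + (1 - t) *\<^sub>R y = y + t *\<^sub>R (xbar - y)"
      by (simp add: algebra_simps)
    then have "h (y + t *\<^sub>R (xbar - y)) \<le> ereal (\<kappa> * t) * h xbar + ereal (1 - \<kappa> * t) * h y
             - ereal (t * (1 - t / (2 - \<kappa>)) * (\<kappa> * \<gamma> / 2) * (norm (y - xbar))\<^sup>2)"
      using sqc y t unfolding strongly_quasar_convex_def by (metis atLeastAtMost_iff)
    then show ?thesis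
      using y xbar by (simp add: hf algebra_simps)
  qed
  obtain U L where U: "open U" "x \<in> U" and fin: "\<forall>y\<in>U. \<bar>h y\<bar> \<noteq> \<infinity>" and lip: "L-lipschitz_on U f"
    using locally_lipschitz_on_edomainE[OF loc x] unfolding f_def by metis
  have dom: "y \<in> edomain h" if "y \<in> U" for y
    using fin that by (auto simp: edomain_def less_top[symmetric])
  \<comment> \<open>\<open>?R\<close> bounds the difference quotients in the direction \<open>xbar - x\<close>. Its first summand is the cost
    of passing to that direction from \<open>xbar - y\<close>, where \<open>y = fst p\<close> is the base point.\<close>
  let ?R = "\<lambda>p. L * norm (x - fst p) + (\<kappa> * (f xbar - f (fst p))
    - (1 - snd p / (2 - \<kappa>)) * (\<kappa> * \<gamma> / 2) * (norm (fst p - xbar))\<^sup>2)"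
  have "isCont f x"
    using lipschitz_on_continuous_on[OF lip] U by (simp add: continuous_on_eq_continuous_at)
  then have "((\<lambda>p. f (fst p)) \<longlongrightarrow> f x) ?F"
    using tendsto_fst_base by (rule isCont_tendsto_compose)
  then have "(?R \<longlongrightarrow> L * norm (x - x) + (\<kappa> * (f xbar - f x)
    - (1 - 0 / (2 - \<kappa>)) * (\<kappa> * \<gamma> / 2) * (norm (x - xbar))\<^sup>2)) ?F"
    using \<kappa> by (intro tendsto_intros tendsto_fst_base tendsto_snd_step) auto
  then have R: "(?R \<longlongrightarrow> \<kappa> * (f xbar - f x) - \<kappa> * \<gamma> / 2 * (norm (x - xbar))\<^sup>2) ?F"
    by simp
  let ?c = "\<kappa> * (f xbar - f x) - \<kappa> * \<gamma> / 2 * (norm (x - xbar))\<^sup>2"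
  have "eventually (\<lambda>(y, t). f (y + t *\<^sub>R (xbar - x)) - f y \<le> (?c + e) * t) ?F" if "0 < e" for e :: real
  proof -
    have "eventually (\<lambda>p. ?R p < ?c + e) ?F"
      using R that by (intro order_tendstoD(2)) auto
    moreover have "eventually (\<lambda>p. snd p < 1) ?F"
      using tendsto_snd_step by (rule order_tendstoD(2)) simp
    moreover have "((\<lambda>p. fst p + snd p *\<^sub>R (xbar - fst p)) \<longlongrightarrow> x + 0 *\<^sub>R (xbar - x)) ?F"
      by (intro tendsto_intros tendsto_fst_base tendsto_snd_step)
    then have "eventually (\<lambda>p. fst p + snd p *\<^sub>R (xbar - fst p) \<in> U) ?F"
      by (rule topological_tendstoD) (use U in auto)
    ultimately show "eventually (\<lambda>(y, t). f (y + t *\<^sub>R (xbar - x)) - f y \<le> (?c + e) * t) ?F"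
      using eventually_clarke_segment[OF U, of "xbar - x"]
    proof eventually_elim
      case (elim p)
      obtain y t where p: "p = (y, t)"
        by (cases p)
      have yt: "y \<in> U" "y + t *\<^sub>R (xbar - x) \<in> U" "y + t *\<^sub>R (xbar - y) \<in> U" "0 < t" "t < 1"
        using elim by (auto simp: p)
      have "f (y + t *\<^sub>R (xbar - x)) - f (y + t *\<^sub>R (xbar - y))
          \<le> L * dist (y + t *\<^sub>R (xbar - x)) (y + t *\<^sub>R (xbar - y))"
        using lipschitz_onD[OF lip yt(2,3)] by (simp add: dist_real_def)
      also have "dist (y + t *\<^sub>R (xbar - x)) (y + t *\<^sub>R (xbar - y)) = norm (t *\<^sub>R (y - x))"
        by (simp add: dist_norm algebra_simps)
      also have "\<dots> = t * norm (x - y)"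
        using yt by (simp add: norm_minus_commute)
      finally have "f (y + t *\<^sub>R (xbar - x)) - f y \<le> ?R p * t"
        using ineq[OF dom dom, of y t] yt by (simp add: p algebra_simps)
      also have "\<dots> \<le> (?c + e) * t"
        using elim yt by (intro mult_right_mono) auto
      finally show ?case
        by (simp add: p)
    qed
  qed
  then show ?thesis
    using clarke_dderiv_le_iff[OF U fin, of "xbar - x" ?c] unfolding f_def by blast
qed

text \<open>Only the single direction \<open>xbar - x\<close> is used along the segment from \<open>x\<close>: at \<open>y = x + u (xbar - x)\<close> one has
  \<open>xbar - y = (1 - u) (xbar - x)\<close>, so a subgradient at \<open>y\<close> that attains the Clarke derivative in the
  direction \<open>xbar - x\<close> turns the subgradient inequality at \<open>y\<close> into the Dini inequality at \<open>u\<close>.\<close>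

lemma strongly_quasar_convex_of_clarke_subdiff:
  fixes h :: "'a::euclidean_space \<Rightarrow> ereal"
  assumes proper: "proper_fun h" and conv: "convex (edomain h)" and min: "xbar \<in> argmin h"
    and \<kappa>: "0 < \<kappa>" "\<kappa> \<le> 1" and \<gamma>: "0 \<le> \<gamma>"
    and loc: "locally_lipschitz_on_edomain h"
    and sub: "\<forall>x\<in>edomain h. \<forall>v\<in>clarke_subdiff h x.
       h x + ereal (1 / \<kappa> * (v \<bullet> (xbar - x))) + ereal (\<gamma> / 2 * (norm (x - xbar))\<^sup>2) \<le> h xbar"
  shows "strongly_quasar_convex \<kappa> \<gamma> h xbar"
proof -
  define f where "f y = real_of_ereal (h y)" for y
  have hf: "h y = ereal (f y)" if "y \<in> edomain h" for y
    using proper_fun_finite_on_edomain[OF proper that] by (simp add: f_def ereal_real)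
  have le: "h xbar \<le> h y" for y
    using min by (simp add: argmin_def is_arg_min_linorder)
  have xbar: "xbar \<in> edomain h"
    using proper le by (force simp: proper_fun_def edomain_def intro: le_less_trans)
  have "h (l *\<^sub>R xbar + (1 - l) *\<^sub>R x) \<le> ereal (\<kappa> * l) * h xbar + ereal (1 - \<kappa> * l) * h x
             - ereal (l * (1 - l / (2 - \<kappa>)) * (\<kappa> * \<gamma> / 2) * (norm (x - xbar))\<^sup>2)"
    if x: "x \<in> edomain h" and l: "l \<in> {0..1}" for x l
  proof -
    define c where "c u = x + u *\<^sub>R (xbar - x)" for u :: real
    define \<psi> where "\<psi> u = f (c u) - f xbar" for u
    have c_conv: "c u = u *\<^sub>R xbar + (1 - u) *\<^sub>R x" for u
      by (simp add: c_def algebra_simps)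
    have c: "c u \<in> edomain h" if "0 \<le> u" "u \<le> 1" for u
      unfolding c_conv using conv xbar x that by (auto simp: convex_def)
    have c_diff: "xbar - c u = (1 - u) *\<^sub>R (xbar - x)" for u
      by (simp add: c_def algebra_simps)
    have c_step: "c (u + t) = c u + t *\<^sub>R (xbar - x)" for u t
      by (simp add: c_def algebra_simps)
    have "\<psi> l \<le> (1 - \<kappa> * l) * \<psi> 0 - l * (1 - l / (2 - \<kappa>)) * (\<kappa> * \<gamma> / 2 * (norm (x - xbar))\<^sup>2)"
    proof (rule quasar_bound_of_Dini_inequality[OF \<kappa>])
      show "continuous_on {0..<1} \<psi>"
      proof (intro continuous_at_imp_continuous_on ballI)
        fix u :: real
        assume "u \<in> {0..<1}"
        then have "c u \<in> edomain h"
          by (intro c) auto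
        then obtain U L where "open U" "c u \<in> U" "L-lipschitz_on U f"
          using locally_lipschitz_on_edomainE[OF loc] unfolding f_def by metis
        then have "isCont f (c u)"
          using lipschitz_on_continuous_on by (metis continuous_on_eq_continuous_at)
        moreover have "isCont c u"
          unfolding c_def by (intro continuous_intros)
        ultimately have "isCont (\<lambda>u. f (c u)) u"
          by (metis isCont_o2)
        then show "isCont \<psi> u"
          unfolding \<psi>_def by (intro isCont_diff continuous_const)
      qed
    next
      fix u e :: real
      assume u: "0 \<le> u" "u < 1" and e: "0 < e"
      let ?y = "c u" and ?d = "xbar - x"
      have y: "?y \<in> edomain h"
        using u by (intro c) auto
      obtain U L where U: "open U" "?y \<in> U" and fin: "\<forall>y\<in>U. \<bar>h y\<bar> \<noteq> \<infinity>"
        and lip: "L-lipschitz_on U (\<lambda>y. real_of_ereal (h y))"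
        using locally_lipschitz_on_edomainE[OF loc y] by metis
      obtain v where v: "v \<in> clarke_subdiff h ?y" "clarke_dderiv h ?y ?d = ereal (v \<bullet> ?d)"
        using clarke_dderiv_attained[OF U fin lip] by blast
      have "f ?y + 1 / \<kappa> * (v \<bullet> (xbar - ?y)) + \<gamma> / 2 * (norm (?y - xbar))\<^sup>2 \<le> f xbar"
        using sub y v(1) xbar by (fastforce simp: hf)
      moreover have "norm (?y - xbar) = (1 - u) * norm (x - xbar)"
        using u by (subst norm_minus_commute) (simp add: c_diff norm_minus_commute)
      ultimately have "(1 - u) * (v \<bullet> ?d) / \<kappa> \<le> - \<psi> u - \<gamma> / 2 * ((1 - u) * norm (x - xbar))\<^sup>2"
        by (simp add: c_diff \<psi>_def)
      then have "v \<bullet> ?d \<le> - \<kappa> / (1 - u) * \<psi> u - \<kappa> * \<gamma> / 2 * (norm (x - xbar))\<^sup>2 * (1 - u)" (is "_ \<le> ?q")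
        using \<kappa> u by (simp add: field_simps power2_eq_square)
      then have "clarke_dderiv h ?y ?d \<le> ereal ?q"
        by (simp add: v)
      then have "eventually (\<lambda>(y, t). f (y + t *\<^sub>R ?d) - f y \<le> (?q + e) * t) (nhds ?y \<times>\<^sub>F at_right 0)"
        using clarke_dderiv_le_iff[OF U fin, of ?d ?q] e unfolding f_def by blast
      moreover have "filterlim (\<lambda>t. (?y, t)) (nhds ?y \<times>\<^sub>F at_right 0) (at_right (0::real))"
        by (intro filterlim_Pair tendsto_const filterlim_ident)
      ultimately have "eventually (\<lambda>t. case (?y, t) of (y, t) \<Rightarrow> f (y + t *\<^sub>R ?d) - f y \<le> (?q + e) * t) (at_right 0)"
        by (rule eventually_compose_filterlim)
      then show "eventually (\<lambda>t. \<psi> (u + t) \<le> \<psi> u + (?q + e) * t) (at_right 0)"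
        by eventually_elim (simp add: \<psi>_def c_step)
    next
      fix u :: real
      assume "0 \<le> u" "u < 1"
      then show "0 \<le> \<psi> u"
        using le[of "c u"] xbar c[of u] by (simp add: \<psi>_def hf)
    qed (use l in \<open>auto simp: \<psi>_def c_def\<close>)
    then have "f (c l) \<le> \<kappa> * l * f xbar + (1 - \<kappa> * l) * f x
        - l * (1 - l / (2 - \<kappa>)) * (\<kappa> * \<gamma> / 2) * (norm (x - xbar))\<^sup>2"
    proof -
      have "a \<le> k * b + (1 - k) * a0 - A * B * N"
        if "a - b \<le> (1 - k) * (a0 - b) - A * (B * N)" for a b a0 k A B N :: real
        using that by (simp add: algebra_simps)
      moreover have "c 0 = x"
        by (simp add: c_def)
      ultimately show ?thesis
        using \<open>\<psi> l \<le> _\<close> unfolding \<psi>_def by metis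
    qed
    then show ?thesis
      using c[of l] l x xbar by (simp add: hf flip: c_conv)
  qed
  then show ?thesis
    using assms by (auto simp: strongly_quasar_convex_def)
qed

theorem theorem31:
  fixes h :: "real ^ 'n \<Rightarrow> ereal" and xbar :: "real ^ 'n" and \<kappa> \<gamma> :: real
  assumes "proper_fun h"
    and "convex (edomain h)"
    and "xbar \<in> argmin h"
    and "0 < \<kappa>" and "\<kappa> \<le> 1" and "0 \<le> \<gamma>"
    and "locally_lipschitz_on_edomain h"
  shows "strongly_quasar_convex \<kappa> \<gamma> h xbar \<longleftrightarrow>
    (\<forall>x\<in>edomain h. \<forall>v\<in>clarke_subdiff h x.
       h xbar \<ge> h x + ereal (1 / \<kappa> * (v \<bullet> (xbar - x))) + ereal (\<gamma> / 2 * (norm (x - xbar))\<^sup>2))"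
proof
  assume sqc: "strongly_quasar_convex \<kappa> \<gamma> h xbar"
  show "\<forall>x\<in>edomain h. \<forall>v\<in>clarke_subdiff h x.
       h xbar \<ge> h x + ereal (1 / \<kappa> * (v \<bullet> (xbar - x))) + ereal (\<gamma> / 2 * (norm (x - xbar))\<^sup>2)"
  proof (intro ballI)
    fix x v
    assume x: "x \<in> edomain h" and v: "v \<in> clarke_subdiff h x"
    have "h xbar \<le> h x"
      using assms(3) by (simp add: argmin_def is_arg_min_linorder)
    then have "xbar \<in> edomain h"
      using x by (auto simp: edomain_def)
    then obtain a b where ab: "h x = ereal a" "h xbar = ereal b"
      using proper_fun_finite_on_edomain[OF assms(1)] x by (metis ereal_real')
    have "ereal (v \<bullet> (xbar - x)) \<le> clarke_dderiv h x (xbar - x)"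
      using v x by (simp add: clarke_subdiff_def)
    also note clarke_dderiv_le_of_strongly_quasar_convex[OF sqc assms(7) x]
    finally have "v \<bullet> (xbar - x) \<le> \<kappa> * (b - a - \<gamma> / 2 * (norm (x - xbar))\<^sup>2)"
      by (simp add: ab algebra_simps)
    then have "v \<bullet> (xbar - x) / \<kappa> \<le> b - a - \<gamma> / 2 * (norm (x - xbar))\<^sup>2"
      using \<open>0 < \<kappa>\<close> by (simp add: divide_le_eq mult.commute)
    then show "h xbar \<ge> h x + ereal (1 / \<kappa> * (v \<bullet> (xbar - x))) + ereal (\<gamma> / 2 * (norm (x - xbar))\<^sup>2)"
      by (simp add: ab)
  qed
next
  assume "\<forall>x\<in>edomain h. \<forall>v\<in>clarke_subdiff h x.
       h xbar \<ge> h x + ereal (1 / \<kappa> * (v \<bullet> (xbar - x))) + ereal (\<gamma> / 2 * (norm (x - xbar))\<^sup>2)"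
  then show "strongly_quasar_convex \<kappa> \<gamma> h xbar"
    using assms by (intro strongly_quasar_convex_of_clarke_subdiff)
qed

end
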